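(* Let $P$ be a Poisson $(2\text{-}3)$-algebra over a field $F$. Suppose that the center $\zeta(P)$ of $P$ has finite codimension $d$ in $P$ (i.e. $\dim_F(P/\zeta(P))=d$ as vector spaces). Then $P$ includes an ideal $K$ of finite dimension at most $\frac{d(d^{2}-1)(d-2)}{6}$ over $F$ such that $P/K$ is abelian.
   Context: A Poisson $(2\text{-}3)$-algebra over a field $F$ is a vector space $P$ over $F$ with an $F$-bilinear product $(a,b)\mapsto ab$ that is commutative and associative (a multiplicative identity is not required by the definition), and an $F$-trilinear operation $[-,-,-]:P\times P\times P\to P$, such that for all elements of $P$: (1) $[a_1,a_2,a_3]=0$ whenever $a_i=a_j$ for some $i\neq j$, $1\leqslant i,j\leqslant 3$; (2) $[[a_1,a_2,a_3],b,c]=[[a_1,b,c],a_2,a_3]+[a_1,[a_2,b,c],a_3]+[a_1,a_2,[a_3,b,c]]$; (3) $[a_1a_2,b,c]=a_2[a_1,b,c]+a_1[a_2,b,c]$. The center of $P$ is $\zeta(P)=\{a\in P \mid [a,b,c]=0 \text{ for all } b,c\in P\}$; it is a vector subspace of $P$. An ideal of $P$ is a vector subspace $I$ such that $ab\in I$ and $[a,b,c]\in I$ for all $a\in I$ and $b,c\in P$; then $P/I$ is a Poisson $(2\text{-}3)$-algebra with the induced operations. A Poisson $(2\text{-}3)$-algebra $Q$ is abelian if $[a,b,c]=0$ for all $a,b,c\in Q$. *)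

theory Defs
  imports Complex_Main "HOL-Algebra.QuotRing" "Jordan_Normal_Form.Missing_VectorSpace"
begin

text \<open>
  The record is an algebra record (carrier, product, addition, scalar multiplication) with a ternary
  operation. The component \<open>one\<close> inherited from \<open>monoid\<close> is unconstrained, since Poisson
  algebras need not be unital.
\<close>

record ('f, 'a) poisson23 = "('f, 'a) module" +
  tbracket :: "'a \<Rightarrow> 'a \<Rightarrow> 'a \<Rightarrow> 'a" (\<open>\<lbrace>_, _, _\<rbrace>\<index>\<close>)

locale poisson23_algebra = vectorspace F P
  for F :: "('f, 'r) ring_scheme" and P :: "('f, 'a, 'm) poisson23_scheme" (structure) +
  assumes mult_closed:
      "\<lbrakk>a \<in> carrier P; b \<in> carrier P\<rbrakk> \<Longrightarrow> a \<otimes> b \<in> carrier P"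
    and mult_comm:
      "\<lbrakk>a \<in> carrier P; b \<in> carrier P\<rbrakk> \<Longrightarrow> a \<otimes> b = b \<otimes> a"
    and mult_assoc:
      "\<lbrakk>a \<in> carrier P; b \<in> carrier P; c \<in> carrier P\<rbrakk> \<Longrightarrow> (a \<otimes> b) \<otimes> c = a \<otimes> (b \<otimes> c)"
    and mult_add_left:
      "\<lbrakk>a \<in> carrier P; a' \<in> carrier P; b \<in> carrier P\<rbrakk> \<Longrightarrow>
        (a \<oplus> a') \<otimes> b = (a \<otimes> b) \<oplus> (a' \<otimes> b)"
    and mult_smult_left:
      "\<lbrakk>r \<in> carrier F; a \<in> carrier P; b \<in> carrier P\<rbrakk> \<Longrightarrow> (r \<odot> a) \<otimes> b = r \<odot> (a \<otimes> b)"
    and mult_add_right: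
      "\<lbrakk>a \<in> carrier P; b \<in> carrier P; b' \<in> carrier P\<rbrakk> \<Longrightarrow>
        a \<otimes> (b \<oplus> b') = (a \<otimes> b) \<oplus> (a \<otimes> b')"
    and mult_smult_right:
      "\<lbrakk>r \<in> carrier F; a \<in> carrier P; b \<in> carrier P\<rbrakk> \<Longrightarrow> a \<otimes> (r \<odot> b) = r \<odot> (a \<otimes> b)"
    and tbracket_closed:
      "\<lbrakk>a \<in> carrier P; b \<in> carrier P; c \<in> carrier P\<rbrakk> \<Longrightarrow> \<lbrace>a, b, c\<rbrace> \<in> carrier P"
    and tbracket_add1:
      "\<lbrakk>a \<in> carrier P; a' \<in> carrier P; b \<in> carrier P; c \<in> carrier P\<rbrakk> \<Longrightarrow>
        \<lbrace>a \<oplus> a', b, c\<rbrace> = \<lbrace>a, b, c\<rbrace> \<oplus> \<lbrace>a', b, c\<rbrace>"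
    and tbracket_add2:
      "\<lbrakk>a \<in> carrier P; b \<in> carrier P; b' \<in> carrier P; c \<in> carrier P\<rbrakk> \<Longrightarrow>
        \<lbrace>a, b \<oplus> b', c\<rbrace> = \<lbrace>a, b, c\<rbrace> \<oplus> \<lbrace>a, b', c\<rbrace>"
    and tbracket_add3:
      "\<lbrakk>a \<in> carrier P; b \<in> carrier P; c \<in> carrier P; c' \<in> carrier P\<rbrakk> \<Longrightarrow>
        \<lbrace>a, b, c \<oplus> c'\<rbrace> = \<lbrace>a, b, c\<rbrace> \<oplus> \<lbrace>a, b, c'\<rbrace>"
    and tbracket_smult1:
      "\<lbrakk>r \<in> carrier F; a \<in> carrier P; b \<in> carrier P; c \<in> carrier P\<rbrakk> \<Longrightarrow>
        \<lbrace>r \<odot> a, b, c\<rbrace> = r \<odot> \<lbrace>a, b, c\<rbrace>"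
    and tbracket_smult2:
      "\<lbrakk>r \<in> carrier F; a \<in> carrier P; b \<in> carrier P; c \<in> carrier P\<rbrakk> \<Longrightarrow>
        \<lbrace>a, r \<odot> b, c\<rbrace> = r \<odot> \<lbrace>a, b, c\<rbrace>"
    and tbracket_smult3:
      "\<lbrakk>r \<in> carrier F; a \<in> carrier P; b \<in> carrier P; c \<in> carrier P\<rbrakk> \<Longrightarrow>
        \<lbrace>a, b, r \<odot> c\<rbrace> = r \<odot> \<lbrace>a, b, c\<rbrace>"
    and tbracket_alt12:
      "\<lbrakk>a \<in> carrier P; b \<in> carrier P\<rbrakk> \<Longrightarrow> \<lbrace>a, a, b\<rbrace> = \<zero>"
    and tbracket_alt13:
      "\<lbrakk>a \<in> carrier P; b \<in> carrier P\<rbrakk> \<Longrightarrow> \<lbrace>a, b, a\<rbrace> = \<zero>"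
    and tbracket_alt23:
      "\<lbrakk>a \<in> carrier P; b \<in> carrier P\<rbrakk> \<Longrightarrow> \<lbrace>b, a, a\<rbrace> = \<zero>"
    and tbracket_derivation:
      "\<lbrakk>a1 \<in> carrier P; a2 \<in> carrier P; a3 \<in> carrier P; b \<in> carrier P; c \<in> carrier P\<rbrakk> \<Longrightarrow>
        \<lbrace>\<lbrace>a1, a2, a3\<rbrace>, b, c\<rbrace> =
          \<lbrace>\<lbrace>a1, b, c\<rbrace>, a2, a3\<rbrace> \<oplus> \<lbrace>a1, \<lbrace>a2, b, c\<rbrace>, a3\<rbrace> \<oplus> \<lbrace>a1, a2, \<lbrace>a3, b, c\<rbrace>\<rbrace>"
    and tbracket_leibniz:
      "\<lbrakk>a1 \<in> carrier P; a2 \<in> carrier P; b \<in> carrier P; c \<in> carrier P\<rbrakk> \<Longrightarrow>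
        \<lbrace>a1 \<otimes> a2, b, c\<rbrace> = (a2 \<otimes> \<lbrace>a1, b, c\<rbrace>) \<oplus> (a1 \<otimes> \<lbrace>a2, b, c\<rbrace>)"

locale abelian_poisson23_algebra = poisson23_algebra F Q
  for F :: "('f, 'r) ring_scheme" and Q :: "('f, 'a, 'm) poisson23_scheme" (structure) +
  assumes tbracket_eq_zero:
    "\<lbrakk>a \<in> carrier Q; b \<in> carrier Q; c \<in> carrier Q\<rbrakk> \<Longrightarrow> \<lbrace>a, b, c\<rbrace> = \<zero>"

definition poisson23_center :: "('f, 'a, 'm) poisson23_scheme \<Rightarrow> 'a set" where
  "poisson23_center P =
    {a \<in> carrier P. \<forall>b \<in> carrier P. \<forall>c \<in> carrier P. \<lbrace>a, b, c\<rbrace>\<^bsub>P\<^esub> = \<zero>\<^bsub>P\<^esub>}"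

locale poisson23_ideal = subspace F I P
  for F :: "('f, 'r) ring_scheme" and I and P :: "('f, 'a, 'm) poisson23_scheme" (structure) +
  assumes ideal_mult: "\<lbrakk>a \<in> I; b \<in> carrier P\<rbrakk> \<Longrightarrow> a \<otimes> b \<in> I"
    and ideal_tbracket: "\<lbrakk>a \<in> I; b \<in> carrier P; c \<in> carrier P\<rbrakk> \<Longrightarrow> \<lbrace>a, b, c\<rbrace> \<in> I"

text \<open>
  Quotient of a vector space by a subspace \<open>W\<close>, in the style of \<^const>\<open>FactRing\<close>. The components
  \<open>mult\<close> and \<open>one\<close> play no role in the vector space structure; the former is the induced product
  only when \<open>W\<close> is also an ideal.
\<close>

definition quotient_space :: "('f, 'a, 'm) module_scheme \<Rightarrow> 'a set \<Rightarrow> ('f, 'a set) module" where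
  "quotient_space V W =
    \<lparr>carrier = a_rcosets\<^bsub>V\<^esub> W, mult = rcoset_mult V W,
      one = W +>\<^bsub>V\<^esub> \<one>\<^bsub>V\<^esub>, zero = W, add = set_add V,
      smult = (\<lambda>r X. \<Union>x\<in>X. W +>\<^bsub>V\<^esub> (r \<odot>\<^bsub>V\<^esub> x))\<rparr>"

definition quotient_poisson23 ::
    "('f, 'a, 'm) poisson23_scheme \<Rightarrow> 'a set \<Rightarrow> ('f, 'a set) poisson23" where
  "quotient_poisson23 P I = module.extend (quotient_space P I)
    (poisson23.fields (\<lambda>X Y Z. \<Union>x\<in>X. \<Union>y\<in>Y. \<Union>z\<in>Z. I +>\<^bsub>P\<^esub> \<lbrace>x, y, z\<rbrace>\<^bsub>P\<^esub>))"

end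

theory Submission
  imports Defs
begin

text \<open>
  Choose a finite set \<open>E\<close> of at most \<open>d\<close> vectors that spans \<open>P\<close> together with the center \<open>Z\<close>. The
  bracket is trilinear and alternating and vanishes as soon as one argument is central, so all
  brackets lie in the span of a set \<open>T\<close> with one bracket \<open>\<lbrace>a, b, c\<rbrace>\<close> for each three-element subset
  of \<open>E\<close>; thus \<open>card T \<le> d choose 3\<close>.

  Let \<open>K\<close> be the span of \<open>T\<close> and of all products \<open>e \<otimes> t\<close> with \<open>e \<in> E\<close> and \<open>t \<in> T\<close>. It contains all
  brackets, so \<open>P / K\<close> has zero bracket and \<open>K\<close> absorbs brackets. For \<open>z\<close> central, the Leibniz rule
  gives \<open>z \<otimes> \<lbrace>a, b, c\<rbrace> = \<lbrace>z \<otimes> a, b, c\<rbrace>\<close>, which is again a bracket; hence \<open>x \<otimes> t \<in> K\<close> for every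
  \<open>x\<close> in the span of \<open>E \<union> Z\<close>, that is, for every \<open>x\<close> in \<open>P\<close>. As
  \<open>(e \<otimes> t) \<otimes> x = t \<otimes> (e \<otimes> x)\<close>, \<open>K\<close> also absorbs products, so it is an ideal. Its dimension is at
  most \<open>(d + 1) * (d choose 3)\<close>, which is the bound.
\<close>

section \<open>Linear algebra: quotients and spanning sets\<close>

lemma UN_constant_eqI:
  assumes "A \<noteq> {}" and "\<And>y. y \<in> A \<Longrightarrow> f y = c"
  shows "(\<Union>y\<in>A. f y) = c"
  using assms by auto

lemma (in module) submodule_imp_abelian_subgroup:
  assumes "submodule R W M"
  shows "abelian_subgroup W M"
proof -
  interpret W: submodule R W M by fact
  have "\<ominus>\<^bsub>M\<^esub> w \<in> W" if "w \<in> W" for w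
    using W.smult_closed that W.subset smult_minus_1 R.one_closed R.a_inv_closed by (metis subsetD)
  moreover have "W \<noteq> {}" using W.zero_closed by blast
  ultimately have "subgroup W (add_monoid M)"
    using W.subset by (intro M.add.subgroupI) (auto simp: a_inv_def)
  then show ?thesis
    by (intro abelian_subgroupI3 additive_subgroupI M.abelian_group_axioms)
qed

lemma (in abelian_subgroup) coset_absorb:
  assumes "w \<in> H" and "x \<in> carrier G"
  shows "H +> (w \<oplus> x) = H +> x"
  using a_repr_independence[OF a_rcosI[OF assms(1) a_subset assms(2)] assms(2) a_subgroup] by simp

lemma (in abelian_subgroup) coset_elimE:
  assumes "y \<in> H +> x"
  obtains w where "w \<in> H" and "y = w \<oplus> x"
  using assms unfolding a_r_coset_def' by auto

lemma (in module) coset_smult: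
  assumes W: "submodule R W M" and r: "r \<in> carrier R" and x: "x \<in> carrier M"
  shows "(\<Union>y\<in>W +>\<^bsub>M\<^esub> x. W +>\<^bsub>M\<^esub> (r \<odot>\<^bsub>M\<^esub> y)) = W +>\<^bsub>M\<^esub> (r \<odot>\<^bsub>M\<^esub> x)"
proof (rule UN_constant_eqI)
  interpret W: submodule R W M by fact
  interpret S: abelian_subgroup W M by (rule submodule_imp_abelian_subgroup[OF W])
  show "W +>\<^bsub>M\<^esub> x \<noteq> {}" using S.a_rcos_self[OF x] by auto
  fix y assume "y \<in> W +>\<^bsub>M\<^esub> x"
  then obtain w where w: "w \<in> W" "y = w \<oplus>\<^bsub>M\<^esub> x" by (rule S.coset_elimE)
  then have "r \<odot>\<^bsub>M\<^esub> y = r \<odot>\<^bsub>M\<^esub> w \<oplus>\<^bsub>M\<^esub> r \<odot>\<^bsub>M\<^esub> x"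
    using W.subset r x by (auto simp: smult_r_distr)
  then show "W +>\<^bsub>M\<^esub> (r \<odot>\<^bsub>M\<^esub> y) = W +>\<^bsub>M\<^esub> (r \<odot>\<^bsub>M\<^esub> x)"
    using w r x by (simp add: S.coset_absorb)
qed

text \<open>
  Only the vector space operations of the quotient are prescribed, so that the lemma applies to
  the bare quotient space as well as to its extensions by further operations.
\<close>
lemma (in vectorspace) quotient_vectorspaceI:
  assumes W: "submodule K W V"
    and Q: "carrier Q = a_rcosets\<^bsub>V\<^esub> W" "zero Q = W" "add Q = set_add V"
      "smult Q = (\<lambda>r X. \<Union>x\<in>X. W +>\<^bsub>V\<^esub> (r \<odot>\<^bsub>V\<^esub> x))"
  shows "vectorspace K Q"
proof -
  interpret S: abelian_subgroup W V by (rule submodule_imp_abelian_subgroup[OF W])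
  let ?q = "\<lambda>x. W +>\<^bsub>V\<^esub> x"
  have car: "carrier Q = ?q ` carrier V"
    unfolding Q A_RCOSETS_def' by auto
  have zer: "zero Q = ?q \<zero>\<^bsub>V\<^esub>"
    using S.a_subset by (simp add: Q)
  have add: "?q x \<oplus>\<^bsub>Q\<^esub> ?q y = ?q (x \<oplus>\<^bsub>V\<^esub> y)" if "x \<in> carrier V" "y \<in> carrier V" for x y
    unfolding Q using that by (rule S.a_rcos_sum)
  have smu: "r \<odot>\<^bsub>Q\<^esub> ?q x = ?q (r \<odot>\<^bsub>V\<^esub> x)" if "r \<in> carrier K" "x \<in> carrier V" for r x
    unfolding Q using coset_smult[OF W that] by simp
  show ?thesis
  proof (rule vs_criteria)
    show "field K" by (rule field_axioms)
    show "\<forall>v\<in>carrier Q. \<exists>neg_v\<in>carrier Q. v \<oplus>\<^bsub>Q\<^esub> neg_v = \<zero>\<^bsub>Q\<^esub>"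
    proof
      fix v assume "v \<in> carrier Q"
      then obtain x where x: "x \<in> carrier V" "v = ?q x" by (auto simp: car)
      then have "v \<oplus>\<^bsub>Q\<^esub> ?q (\<ominus>\<^bsub>V\<^esub> x) = \<zero>\<^bsub>Q\<^esub>" by (simp add: zer add M.r_neg)
      then show "\<exists>neg_v\<in>carrier Q. v \<oplus>\<^bsub>Q\<^esub> neg_v = \<zero>\<^bsub>Q\<^esub>" using x by (auto simp: car)
    qed
  qed (auto simp: car zer add smu M.a_ac smult_l_distr smult_r_distr smult_assoc1)
qed

lemma (in vectorspace) vectorspace_quotient_space:
  assumes "submodule K W V"
  shows "vectorspace K (quotient_space V W)"
  by (rule quotient_vectorspaceI[OF assms]) (simp_all add: quotient_space_def)

text \<open>The representatives of a basis of \<open>V / W\<close> span \<open>V\<close> together with \<open>W\<close>.\<close>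
lemma (in vectorspace) obtain_spanning_complement:
  assumes W: "submodule K W V" and fin: "vectorspace.fin_dim K (quotient_space V W)"
  obtains E where "finite E" and "E \<subseteq> carrier V"
    and "card E \<le> vectorspace.dim K (quotient_space V W)" and "span (E \<union> W) = carrier V"
proof -
  let ?Q = "quotient_space V W"
  interpret W: submodule K W V by fact
  interpret S: abelian_subgroup W V by (rule submodule_imp_abelian_subgroup[OF W])
  interpret Q: vectorspace K ?Q by (rule vectorspace_quotient_space[OF W])
  let ?q = "\<lambda>x. W +>\<^bsub>V\<^esub> x"
  have car: "carrier ?Q = ?q ` carrier V"
    unfolding quotient_space_def A_RCOSETS_def' by auto
  have hom: "?q \<in> module_hom K V ?Q"
    unfolding module_hom_def
    using coset_smult[OF W] by (auto simp: car) (auto simp: quotient_space_def S.a_rcos_sum)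
  interpret q: mod_hom K V ?Q ?q
    by unfold_locales (rule hom)
  obtain B where B: "finite B" "Q.basis B"
    using Q.finite_basis_exists[OF fin] by auto
  have "B \<subseteq> ?q ` carrier V" using B(2) by (auto simp: Q.basis_def car)
  then obtain E where E: "E \<subseteq> carrier V" "inj_on ?q E" "?q ` E = B"
    using subset_image_inj[of B ?q "carrier V"] by metis
  have finE: "finite E" using B(1) E finite_imageD by metis
  have cardE: "card E \<le> Q.dim"
    using Q.dim_basis[OF B] E card_image by (metis le_refl)
  have sub: "E \<union> W \<subseteq> carrier V" using E W.subset by auto
  have span: "submodule K (span (E \<union> W)) V" by (rule span_is_submodule[OF sub])
  then interpret U: submodule K "span (E \<union> W)" V .
  interpret r: mod_hom K "vs (span (E \<union> W))" ?Q ?q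
  proof (intro mod_hom.intro mod_hom_axioms.intro)
    show "module K (vs (span (E \<union> W)))" by (rule submodule_is_module[OF span])
    show "module K ?Q" by (rule Q.module_axioms)
    show "?q \<in> module_hom K (vs (span (E \<union> W))) ?Q"
      using hom U.subset by (auto simp: module_hom_def Pi_def subset_iff)
  qed
  have "submodule K (?q ` span (E \<union> W)) ?Q"
    using r.im_is_submodule unfolding r.im_def by simp
  moreover have "B \<subseteq> ?q ` span (E \<union> W)"
    using E in_own_span[OF sub] by auto
  ultimately have "Q.span B \<subseteq> ?q ` span (E \<union> W)"
    by (intro Q.span_is_subset)
  then have surj: "?q ` carrier V \<subseteq> ?q ` span (E \<union> W)"
    using B(2) by (simp add: Q.basis_def car)
  have "x \<in> span (E \<union> W)" if x: "x \<in> carrier V" for x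
  proof -
    obtain y where y: "y \<in> span (E \<union> W)" "?q x = ?q y" using surj x by blast
    have "x \<in> ?q y" using S.a_rcos_self[OF x] y by simp
    then obtain w where "w \<in> W" "x = w \<oplus>\<^bsub>V\<^esub> y" by (rule S.coset_elimE)
    then show ?thesis using y in_own_span[OF sub] by auto
  qed
  then have "span (E \<union> W) = carrier V" using U.subset by auto
  then show thesis using that finE E(1) cardE by blast
qed

text \<open>
  To check that a linear map sends a span into a submodule it is enough to look at the spanning
  vectors. This replaces all computations with linear combinations.
\<close>
lemma (in module) module_hom_span_mem:
  assumes f: "f \<in> module_hom R M M" and U: "submodule R U M" and A: "A \<subseteq> carrier M"
    and fA: "\<And>a. a \<in> A \<Longrightarrow> f a \<in> U" and x: "x \<in> span A"
  shows "f x \<in> U"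
proof -
  interpret f: mod_hom R M M f by unfold_locales (rule f)
  interpret U: submodule R U M by fact
  have "submodule R {x \<in> carrier M. f x \<in> U} M"
    by (rule submodule.intro) (auto simp: module_axioms)
  then have "span A \<subseteq> {x \<in> carrier M. f x \<in> U}"
    by (intro span_is_subset) (use A fA in auto)
  then show ?thesis using x by auto
qed

lemma (in vectorspace) span_dim_le_card:
  assumes "finite A" and "A \<subseteq> carrier V"
  shows "vectorspace.fin_dim K (vs (span A))" and "vectorspace.dim K (vs (span A)) \<le> card A"
proof -
  interpret S: vectorspace K "vs (span A)"
    by (rule subspace_is_vs[OF span_is_subspace[OF assms(2)]])
  have sub: "A \<subseteq> carrier (vs (span A))" using in_own_span[OF assms(2)] by simp
  have gen: "S.span A = carrier (vs (span A))"
    using span_li_not_depend(1)[OF in_own_span span_is_submodule] assms(2) by simp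
  show "S.fin_dim" unfolding S.fin_dim_def using assms(1) sub gen by blast
  show "S.dim \<le> card A" by (rule S.gen_ge_dim[OF assms(1) sub gen])
qed

lemma (in abelian_group) alternating_imp_skew:
  assumes closed: "\<And>x y. \<lbrakk>x \<in> carrier G; y \<in> carrier G\<rbrakk> \<Longrightarrow> f x y \<in> carrier G"
    and add1: "\<And>x x' y. \<lbrakk>x \<in> carrier G; x' \<in> carrier G; y \<in> carrier G\<rbrakk>
      \<Longrightarrow> f (x \<oplus> x') y = f x y \<oplus> f x' y"
    and add2: "\<And>x y y'. \<lbrakk>x \<in> carrier G; y \<in> carrier G; y' \<in> carrier G\<rbrakk>
      \<Longrightarrow> f x (y \<oplus> y') = f x y \<oplus> f x y'"
    and alt: "\<And>x. x \<in> carrier G \<Longrightarrow> f x x = \<zero>"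
    and a: "a \<in> carrier G" and b: "b \<in> carrier G"
  shows "f b a = \<ominus> f a b"
proof -
  have "\<zero> = f (a \<oplus> b) (a \<oplus> b)" using a b by (simp add: alt)
  also have "\<dots> = (f a a \<oplus> f a b) \<oplus> (f b a \<oplus> f b b)" using a b by (simp add: add1 add2 closed a_ac)
  also have "\<dots> = f b a \<oplus> f a b" using a b by (simp add: alt closed a_comm)
  finally show ?thesis using a b closed by (metis minus_equality)
qed

section \<open>Brackets and the center\<close>

context poisson23_algebra
begin

lemma tbracket_swap12:
  assumes "a \<in> carrier P" "b \<in> carrier P" "c \<in> carrier P"
  shows "\<lbrace>b, a, c\<rbrace> = \<ominus> \<lbrace>a, b, c\<rbrace>"
  by (rule alternating_imp_skew[where f = "\<lambda>x y. \<lbrace>x, y, c\<rbrace>"])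
    (use assms in \<open>simp_all add: tbracket_closed tbracket_add1 tbracket_add2 tbracket_alt12\<close>)

lemma tbracket_swap13:
  assumes "a \<in> carrier P" "b \<in> carrier P" "c \<in> carrier P"
  shows "\<lbrace>c, b, a\<rbrace> = \<ominus> \<lbrace>a, b, c\<rbrace>"
  by (rule alternating_imp_skew[where f = "\<lambda>x y. \<lbrace>x, b, y\<rbrace>"])
    (use assms in \<open>simp_all add: tbracket_closed tbracket_add1 tbracket_add3 tbracket_alt13\<close>)

lemma tbracket_swap23:
  assumes "a \<in> carrier P" "b \<in> carrier P" "c \<in> carrier P"
  shows "\<lbrace>a, c, b\<rbrace> = \<ominus> \<lbrace>a, b, c\<rbrace>"
  by (rule alternating_imp_skew[where f = "\<lambda>x y. \<lbrace>a, x, y\<rbrace>"])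
    (use assms in \<open>simp_all add: tbracket_closed tbracket_add2 tbracket_add3 tbracket_alt23\<close>)

lemma module_hom_tbracket:
  assumes "b \<in> carrier P" "c \<in> carrier P"
  shows "(\<lambda>x. \<lbrace>x, b, c\<rbrace>) \<in> module_hom F P P"
    and "(\<lambda>x. \<lbrace>b, x, c\<rbrace>) \<in> module_hom F P P"
    and "(\<lambda>x. \<lbrace>b, c, x\<rbrace>) \<in> module_hom F P P"
  using assms unfolding module_hom_def
  by (auto simp: tbracket_closed tbracket_add1 tbracket_add2 tbracket_add3
      tbracket_smult1 tbracket_smult2 tbracket_smult3)

lemma module_hom_mult:
  assumes "b \<in> carrier P"
  shows "(\<lambda>x. x \<otimes> b) \<in> module_hom F P P" and "(\<lambda>x. b \<otimes> x) \<in> module_hom F P P"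
  using assms unfolding module_hom_def
  by (auto simp: mult_closed mult_add_left mult_smult_left mult_add_right mult_smult_right)

lemma centerD:
  assumes "z \<in> poisson23_center P"
  shows "z \<in> carrier P"
    and "\<lbrakk>b \<in> carrier P; c \<in> carrier P\<rbrakk> \<Longrightarrow> \<lbrace>z, b, c\<rbrace> = \<zero>"
    and "\<lbrakk>b \<in> carrier P; c \<in> carrier P\<rbrakk> \<Longrightarrow> \<lbrace>b, z, c\<rbrace> = \<zero>"
    and "\<lbrakk>b \<in> carrier P; c \<in> carrier P\<rbrakk> \<Longrightarrow> \<lbrace>b, c, z\<rbrace> = \<zero>"
  using assms tbracket_swap12[of z b c] tbracket_swap13[of z c b]
  by (auto simp: poisson23_center_def)

lemma submodule_center: "submodule F (poisson23_center P) P"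
proof (rule submodule.intro)
  show "module F P" by (rule module_axioms)
  have "\<lbrace>\<zero>, b, c\<rbrace> = \<zero>" if bc: "b \<in> carrier P" "c \<in> carrier P" for b c
  proof -
    interpret h: mod_hom F P P "\<lambda>x. \<lbrace>x, b, c\<rbrace>"
      by unfold_locales (rule module_hom_tbracket(1)[OF bc])
    show ?thesis by (rule h.f0_is_0)
  qed
  then show "\<zero> \<in> poisson23_center P" by (auto simp: poisson23_center_def)
qed (auto simp: poisson23_center_def tbracket_add1 tbracket_smult1)

text \<open>Brackets with a central argument vanish, so central vectors do not contribute.\<close>
lemma tbracket_mem_if_spanning:
  assumes E: "E \<subseteq> carrier P" and gen: "span (E \<union> poisson23_center P) = carrier P"
    and U: "submodule F U P"
    and EU: "\<And>a b c. \<lbrakk>a \<in> E; b \<in> E; c \<in> E\<rbrakk> \<Longrightarrow> \<lbrace>a, b, c\<rbrace> \<in> U"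
    and xyz: "x \<in> carrier P" "y \<in> carrier P" "z \<in> carrier P"
  shows "\<lbrace>x, y, z\<rbrace> \<in> U"
proof -
  let ?A = "E \<union> poisson23_center P"
  have A: "?A \<subseteq> carrier P" using E centerD(1) by auto
  have zero: "\<zero> \<in> U" using U by (simp add: submodule_def)
  have 1: "\<lbrace>a, b, c\<rbrace> \<in> U" if "a \<in> ?A" "b \<in> ?A" "c \<in> ?A" for a b c
  proof (cases "a \<in> E \<and> b \<in> E \<and> c \<in> E")
    case False
    then have "\<lbrace>a, b, c\<rbrace> = \<zero>" using that A by (auto intro: centerD)
    then show ?thesis using zero by simp
  qed (use EU in auto)
  have 2: "\<lbrace>x, b, c\<rbrace> \<in> U" if "b \<in> ?A" "c \<in> ?A" for b c
    by (rule module_hom_span_mem[OF module_hom_tbracket(1) U A]) (use that A gen xyz 1 in auto)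
  have 3: "\<lbrace>x, y, c\<rbrace> \<in> U" if "c \<in> ?A" for c
    by (rule module_hom_span_mem[OF module_hom_tbracket(2) U A]) (use that A gen xyz 2 in auto)
  show ?thesis
    by (rule module_hom_span_mem[OF module_hom_tbracket(3) U A]) (use A gen xyz 3 in auto)
qed

text \<open>
  One bracket is chosen for each three-element subset of \<open>E\<close>; the brackets of the other orderings
  of the same subset differ from it by a sign only.
\<close>
lemma obtain_tbracket_generators:
  assumes finE: "finite E" and E: "E \<subseteq> carrier P"
  obtains T where "finite T" and "card T \<le> card E choose 3"
    and "\<And>t. t \<in> T \<Longrightarrow> \<exists>a\<in>E. \<exists>b\<in>E. \<exists>c\<in>E. t = \<lbrace>a, b, c\<rbrace>"
    and "\<And>a b c. \<lbrakk>a \<in> E; b \<in> E; c \<in> E\<rbrakk> \<Longrightarrow> \<lbrace>a, b, c\<rbrace> \<in> span T"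
proof -
  let ?S = "{S. S \<subseteq> E \<and> card S = 3}"
  have "\<forall>S\<in>?S. \<exists>t. \<exists>a b c. S = {a, b, c} \<and> t = \<lbrace>a, b, c\<rbrace>"
    by (auto simp: card_3_iff)
  from bchoice[OF this] obtain w
    where w: "\<forall>S\<in>?S. \<exists>a b c. S = {a, b, c} \<and> w S = \<lbrace>a, b, c\<rbrace>" ..
  define T where "T = w ` ?S"
  have finS: "finite ?S" using finE by simp
  have T: "\<exists>a\<in>E. \<exists>b\<in>E. \<exists>c\<in>E. t = \<lbrace>a, b, c\<rbrace>" if "t \<in> T" for t
  proof -
    obtain S where S: "S \<in> ?S" "t = w S" using \<open>t \<in> T\<close> unfolding T_def by auto
    then obtain a b c where "S = {a, b, c}" "w S = \<lbrace>a, b, c\<rbrace>" using w[rule_format] by metis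
    then show ?thesis using S by auto
  qed
  have TP: "T \<subseteq> carrier P"
  proof -
    have "t \<in> carrier P" if "t \<in> T" for t
      using T[OF that] E by (auto intro!: tbracket_closed)
    then show ?thesis by auto
  qed
  have "\<lbrace>a, b, c\<rbrace> \<in> span T" if abc: "a \<in> E" "b \<in> E" "c \<in> E" for a b c
  proof (cases "a = b \<or> a = c \<or> b = c")
    case True
    then have "\<lbrace>a, b, c\<rbrace> = \<zero>"
      using abc E by (auto intro!: tbracket_alt12 tbracket_alt13 tbracket_alt23)
    then show ?thesis by (simp add: span_zero)
  next
    case False
    then have S: "{a, b, c} \<in> ?S" using abc by auto
    then obtain a' b' c' where w': "{a, b, c} = {a', b', c'}" "w {a, b, c} = \<lbrace>a', b', c'\<rbrace>"
      using w[rule_format, OF S] by metis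
    have "w {a, b, c} \<in> T" unfolding T_def using S by (rule imageI)
    then have mem: "\<lbrace>a', b', c'\<rbrace> \<in> span T"
      unfolding w'(2) by (rule subsetD[OF in_own_span[OF TP]])
    then have neg: "\<ominus> \<lbrace>a', b', c'\<rbrace> \<in> span T" by (rule span_neg[OF TP])
    have P: "a \<in> carrier P" "b \<in> carrier P" "c \<in> carrier P" using abc E by auto
    have "a \<in> {a', b', c'}" "b \<in> {a', b', c'}" "c \<in> {a', b', c'}"
      using w'(1) by auto
    then have "(a' = a \<and> b' = b \<and> c' = c) \<or> (a' = a \<and> b' = c \<and> c' = b) \<or>
      (a' = b \<and> b' = a \<and> c' = c) \<or> (a' = b \<and> b' = c \<and> c' = a) \<or>
      (a' = c \<and> b' = a \<and> c' = b) \<or> (a' = c \<and> b' = b \<and> c' = a)"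
      using False by auto
    then have "\<lbrace>a, b, c\<rbrace> = \<lbrace>a', b', c'\<rbrace> \<or> \<lbrace>a, b, c\<rbrace> = \<ominus> \<lbrace>a', b', c'\<rbrace>"
    proof (elim disjE conjE, goal_cases)
      case 4
      then show ?case using P tbracket_swap12[of a b c] tbracket_swap23[of b a c]
        by (simp add: tbracket_closed)
    next
      case 5
      then show ?case using P tbracket_swap12[of a c b] tbracket_swap23[of a b c]
        by (simp add: tbracket_closed)
    qed (use P in \<open>simp_all add: tbracket_swap12[of a b c] tbracket_swap13[of a b c]
        tbracket_swap23[of a b c] tbracket_closed\<close>)
    then show ?thesis using mem neg by auto
  qed
  moreover have "card T \<le> card E choose 3"
    unfolding T_def using card_image_le[OF finS, of w] n_subsets[OF finE, of 3] by simp
  moreover have "finite T" unfolding T_def using finS by simp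
  ultimately show thesis using that T by blast
qed

section \<open>The ideal and its quotient\<close>

text \<open>
  This keeps the ideal finite-dimensional: multiplying a bracket by a central element gives no
  more than another bracket.
\<close>
lemma center_mult_tbracket:
  assumes "z \<in> poisson23_center P" "a \<in> carrier P" "b \<in> carrier P" "c \<in> carrier P"
  shows "\<lbrace>a, b, c\<rbrace> \<otimes> z = \<lbrace>z \<otimes> a, b, c\<rbrace>"
proof -
  note z = centerD[OF assms(1)]
  interpret h: mod_hom F P P "\<lambda>x. a \<otimes> x"
    by unfold_locales (rule module_hom_mult(2)[OF assms(2)])
  have "\<lbrace>z \<otimes> a, b, c\<rbrace> = a \<otimes> \<lbrace>z, b, c\<rbrace> \<oplus> z \<otimes> \<lbrace>a, b, c\<rbrace>"
    using assms z by (intro tbracket_leibniz)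
  then show ?thesis
    using assms z h.f0_is_0 by (simp add: tbracket_closed mult_closed mult_comm[of _ z])
qed

lemma obtain_ideal_containing_tbrackets:
  assumes finE: "finite E" and E: "E \<subseteq> carrier P"
    and gen: "span (E \<union> poisson23_center P) = carrier P"
  obtains A where "finite A" and "A \<subseteq> carrier P"
    and "card A \<le> (card E + 1) * (card E choose 3)" and "poisson23_ideal F (span A) P"
    and "\<And>x y z. \<lbrakk>x \<in> carrier P; y \<in> carrier P; z \<in> carrier P\<rbrakk> \<Longrightarrow> \<lbrace>x, y, z\<rbrace> \<in> span A"
proof -
  obtain T where finT: "finite T" and cardT: "card T \<le> card E choose 3"
    and T: "\<And>t. t \<in> T \<Longrightarrow> \<exists>a\<in>E. \<exists>b\<in>E. \<exists>c\<in>E. t = \<lbrace>a, b, c\<rbrace>"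
    and ET: "\<And>a b c. \<lbrakk>a \<in> E; b \<in> E; c \<in> E\<rbrakk> \<Longrightarrow> \<lbrace>a, b, c\<rbrace> \<in> span T"
    using obtain_tbracket_generators[OF finE E] by blast
  have TP: "t \<in> carrier P" if "t \<in> T" for t
    using T[OF that] E by (auto intro!: tbracket_closed)
  define M where "M = (\<lambda>(e, t). e \<otimes> t) ` (E \<times> T)"
  define A where "A = T \<union> M"
  have finA: "finite A" unfolding A_def M_def using finE finT by simp
  have AP: "A \<subseteq> carrier P" unfolding A_def M_def using E TP by (auto intro!: mult_closed)
  have cardM: "card M \<le> card E * card T"
    unfolding M_def using card_image_le[of "E \<times> T" "\<lambda>(e, t). e \<otimes> t"] finE finT
    by (simp add: card_cartesian_product)
  have cardA: "card A \<le> (card E + 1) * (card E choose 3)"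
  proof -
    have "card A \<le> card T + card E * card T"
      unfolding A_def using card_Un_le[of T M] cardM by linarith
    also have "\<dots> = (card E + 1) * card T" by simp
    also have "\<dots> \<le> (card E + 1) * (card E choose 3)" using cardT by (rule mult_le_mono2)
    finally show ?thesis .
  qed
  have sub: "submodule F (span A) P" by (rule span_is_submodule[OF AP])
  have TA: "span T \<subseteq> span A" by (rule span_is_monotone) (simp add: A_def)
  have bra: "\<lbrace>x, y, z\<rbrace> \<in> span A" if "x \<in> carrier P" "y \<in> carrier P" "z \<in> carrier P" for x y z
    by (rule tbracket_mem_if_spanning[OF E gen sub]) (use ET TA that in auto)
  \<comment> \<open>Linearity reduces this to \<open>x \<in> E\<close>, where the product is a generator up to order, and to
    central \<open>x\<close>, where the product is a bracket.\<close>
  have tx: "t \<otimes> x \<in> span A" if t: "t \<in> T" and x: "x \<in> carrier P" for t x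
  proof (rule module_hom_span_mem[OF module_hom_mult(2)[OF TP[OF t]] sub])
    show "E \<union> poisson23_center P \<subseteq> carrier P" using E centerD(1) by auto
    show "x \<in> span (E \<union> poisson23_center P)" using gen x by simp
    fix e assume "e \<in> E \<union> poisson23_center P"
    then show "t \<otimes> e \<in> span A"
    proof
      assume e: "e \<in> E"
      then have "e \<otimes> t \<in> A" using t unfolding A_def M_def by force
      moreover have "t \<otimes> e = e \<otimes> t" using TP[OF t] e E by (intro mult_comm) auto
      ultimately show ?thesis using in_own_span[OF AP] by auto
    next
      assume e: "e \<in> poisson23_center P"
      obtain a b c where abc: "a \<in> carrier P" "b \<in> carrier P" "c \<in> carrier P"
        and "t = \<lbrace>a, b, c\<rbrace>"
        using T[OF t] E by blast
      then have "t \<otimes> e = \<lbrace>e \<otimes> a, b, c\<rbrace>" using e by (simp add: center_mult_tbracket)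
      then show ?thesis using abc e by (simp add: bra mult_closed centerD(1))
    qed
  qed
  have ax: "k \<otimes> x \<in> span A" if k: "k \<in> span A" and x: "x \<in> carrier P" for k x
  proof (rule module_hom_span_mem[OF module_hom_mult(1)[OF x] sub AP _ k])
    fix a assume "a \<in> A"
    then show "a \<otimes> x \<in> span A"
    proof (cases "a \<in> T")
      case False
      then obtain e t where et: "e \<in> E" "t \<in> T" "a = e \<otimes> t"
        using \<open>a \<in> A\<close> unfolding A_def M_def by auto
      have eP: "e \<in> carrier P" using et E by auto
      have "a \<otimes> x = t \<otimes> (e \<otimes> x)"
        using eP TP[OF et(2)] x by (simp add: et(3) mult_comm[of e t] mult_assoc)
      then show ?thesis using tx[OF et(2)] eP x by (simp add: mult_closed)
    qed (use tx x in auto)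
  qed
  have "poisson23_ideal F (span A) P"
  proof (intro poisson23_ideal.intro poisson23_ideal_axioms.intro)
    show "subspace F (span A) P" by (rule span_is_subspace[OF AP])
  qed (use ax bra AP span_closed in auto)
  then show thesis using that finA AP cardA bra by blast
qed

lemma coset_mult:
  assumes I: "poisson23_ideal F I P" and x: "x \<in> carrier P" and y: "y \<in> carrier P"
  shows "rcoset_mult P I (I +> x) (I +> y) = I +> (x \<otimes> y)"
proof -
  interpret I: poisson23_ideal F I P by fact
  interpret W: submodule F I P by (rule I.submod)
  interpret S: abelian_subgroup I P by (rule submodule_imp_abelian_subgroup[OF I.submod])
  have "I +> (a \<otimes> b) = I +> (x \<otimes> y)" if a: "a \<in> I +> x" and b: "b \<in> I +> y" for a b
  proof -
    obtain u where u: "u \<in> I" "a = u \<oplus> x" using a by (rule S.coset_elimE)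
    obtain v where v: "v \<in> I" "b = v \<oplus> y" using b by (rule S.coset_elimE)
    have P: "u \<in> carrier P" "v \<in> carrier P" using u v W.subset by auto
    have 1: "u \<otimes> b \<in> I" using u v P y by (intro I.ideal_mult) auto
    have 2: "x \<otimes> v \<in> I" using I.ideal_mult[OF v(1) x] mult_comm P x by simp
    have "a \<otimes> b = u \<otimes> b \<oplus> (x \<otimes> v \<oplus> x \<otimes> y)"
      using P x y u(2) v(2) by (simp add: mult_add_left mult_add_right mult_closed M.a_ac)
    then show ?thesis
      using 1 2 P x y by (simp add: S.coset_absorb mult_closed)
  qed
  then show ?thesis
    unfolding rcoset_mult_def
    using S.a_rcos_self[OF x] S.a_rcos_self[OF y] by blast
qed

text \<open>
  The induced bracket is identically zero here. The identities involving the bracket hold in the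
  quotient for that reason, and only those of the product are inherited from \<open>P\<close>.
\<close>
lemma abelian_quotient_if_tbracket_mem:
  assumes I: "poisson23_ideal F I P"
    and bra: "\<And>x y z. \<lbrakk>x \<in> carrier P; y \<in> carrier P; z \<in> carrier P\<rbrakk> \<Longrightarrow> \<lbrace>x, y, z\<rbrace> \<in> I"
  shows "abelian_poisson23_algebra F (quotient_poisson23 P I)"
proof -
  interpret I: poisson23_ideal F I P by fact
  interpret W: submodule F I P by (rule I.submod)
  interpret S: abelian_subgroup I P by (rule submodule_imp_abelian_subgroup[OF I.submod])
  define Q where "Q = quotient_poisson23 P I"
  let ?q = "\<lambda>x. I +> x"
  note Q_simps = Q_def quotient_poisson23_def quotient_space_def module.defs poisson23.defs
  interpret Q: vectorspace F Q
    by (rule quotient_vectorspaceI[OF I.submod]) (simp_all add: Q_simps)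
  have car: "carrier Q = ?q ` carrier P"
    by (auto simp: Q_simps A_RCOSETS_def')
  have add: "?q x \<oplus>\<^bsub>Q\<^esub> ?q y = ?q (x \<oplus> y)" if "x \<in> carrier P" "y \<in> carrier P" for x y
    using S.a_rcos_sum[OF that] by (simp add: Q_simps)
  have smu: "r \<odot>\<^bsub>Q\<^esub> ?q x = ?q (r \<odot> x)" if "r \<in> carrier F" "x \<in> carrier P" for r x
    using coset_smult[OF I.submod that] by (simp add: Q_simps)
  have mul: "?q x \<otimes>\<^bsub>Q\<^esub> ?q y = ?q (x \<otimes> y)" if "x \<in> carrier P" "y \<in> carrier P" for x y
    using coset_mult[OF I that] by (simp add: Q_simps)
  have tri: "\<lbrace>X, Y, Z\<rbrace>\<^bsub>Q\<^esub> = \<zero>\<^bsub>Q\<^esub>"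
    if XYZ: "X \<in> carrier Q" "Y \<in> carrier Q" "Z \<in> carrier Q" for X Y Z
  proof -
    have "I +> \<lbrace>x, y, z\<rbrace> = I" if "x \<in> X" "y \<in> Y" "z \<in> Z" for x y z
    proof -
      have "x \<in> carrier P" "y \<in> carrier P" "z \<in> carrier P"
        using XYZ that a_r_coset_subset_G[OF W.subset] by (auto simp: car)
      then show ?thesis
        by (intro a_coset_join2 S.a_subgroup bra tbracket_closed)
    qed
    moreover have "X \<noteq> {}" "Y \<noteq> {}" "Z \<noteq> {}"
      using XYZ S.a_rcos_self by (force simp: car)+
    ultimately have "(\<Union>x\<in>X. \<Union>y\<in>Y. \<Union>z\<in>Z. I +> \<lbrace>x, y, z\<rbrace>) = I" by auto
    then show ?thesis by (simp add: Q_simps)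
  qed
  have zero: "X \<otimes>\<^bsub>Q\<^esub> \<zero>\<^bsub>Q\<^esub> = \<zero>\<^bsub>Q\<^esub>" if X: "X \<in> carrier Q" for X
  proof -
    obtain x where x: "x \<in> carrier P" "X = ?q x" using X by (auto simp: car)
    interpret h: mod_hom F P P "\<lambda>y. x \<otimes> y"
      by unfold_locales (rule module_hom_mult(2)[OF x(1)])
    have "\<zero>\<^bsub>Q\<^esub> = ?q \<zero>" using W.subset by (simp add: Q_simps)
    then show ?thesis using x h.f0_is_0 by (simp add: mul)
  qed
  have closed: "X \<otimes>\<^bsub>Q\<^esub> Y \<in> carrier Q" if "X \<in> carrier Q" "Y \<in> carrier Q" for X Y
    using that by (auto simp: car mul mult_closed)
  have comm: "X \<otimes>\<^bsub>Q\<^esub> Y = Y \<otimes>\<^bsub>Q\<^esub> X" if XY: "X \<in> carrier Q" "Y \<in> carrier Q" for X Y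
  proof -
    obtain x y where "x \<in> carrier P" "X = ?q x" "y \<in> carrier P" "Y = ?q y"
      using XY by (auto simp: car)
    then show ?thesis by (simp add: mul mult_comm[of x y])
  qed
  have "poisson23_algebra_axioms F Q"
  proof (rule poisson23_algebra_axioms.intro, goal_cases)
    case 1
    then show ?case by (rule closed)
  next
    case 2
    then show ?case by (rule comm)
  next
    case 3
    then show ?case by (auto simp: car mul mult_closed mult_assoc)
  next
    case 4
    then show ?case by (auto simp: car mul add mult_closed mult_add_left)
  next
    case 5
    then show ?case by (auto simp: car mul smu mult_closed mult_smult_left)
  next
    case 6
    then show ?case by (auto simp: car mul add mult_closed mult_add_right)
  next
    case 7
    then show ?case by (auto simp: car mul smu mult_closed mult_smult_right)
  qed (simp_all add: tri closed zero)
  then have "poisson23_algebra F Q"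
    by (intro poisson23_algebra.intro Q.vectorspace_axioms)
  then show ?thesis
    unfolding Q_def[symmetric] using tri
    by (intro abelian_poisson23_algebra.intro abelian_poisson23_algebra_axioms.intro)
qed

end

section \<open>The dimension bound\<close>

lemma real_choose_2: "real (n choose 2) = real n * (real n - 1) / 2"
  by (induction n) (simp_all add: numeral_2_eq_2 field_simps)

lemma real_choose_3: "real (n choose 3) = real n * (real n - 1) * (real n - 2) / 6"
proof (induction n)
  case (Suc n)
  have "Suc n choose 3 = (n choose 2) + (n choose 3)"
    by (simp add: numeral_3_eq_3 numeral_2_eq_2)
  then show ?case using Suc by (simp add: real_choose_2 field_simps)
qed simp

theorem theorem3p2:
  fixes F :: "('f, 'r) ring_scheme"
    and P :: "('f, 'a, 'm) poisson23_scheme"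
    and d :: nat
  assumes "poisson23_algebra F P"
    and "vectorspace.fin_dim F (quotient_space P (poisson23_center P))"
    and "vectorspace.dim F (quotient_space P (poisson23_center P)) = d"
  shows "\<exists>K. poisson23_ideal F K P \<and>
    vectorspace.fin_dim F (P\<lparr>carrier := K\<rparr>) \<and>
    real (vectorspace.dim F (P\<lparr>carrier := K\<rparr>)) \<le> real d * ((real d)\<^sup>2 - 1) * (real d - 2) / 6 \<and>
    abelian_poisson23_algebra F (quotient_poisson23 P K)"
proof -
  interpret poisson23_algebra F P by fact
  obtain E where E: "finite E" "E \<subseteq> carrier P" "card E \<le> d"
    "span (E \<union> poisson23_center P) = carrier P"
    using obtain_spanning_complement[OF submodule_center assms(2)] assms(3) by blast
  obtain A where A: "finite A" "A \<subseteq> carrier P"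
    "card A \<le> (card E + 1) * (card E choose 3)" "poisson23_ideal F (span A) P"
    "\<And>x y z. \<lbrakk>x \<in> carrier P; y \<in> carrier P; z \<in> carrier P\<rbrakk> \<Longrightarrow> \<lbrace>x, y, z\<rbrace>\<^bsub>P\<^esub> \<in> span A"
    using obtain_ideal_containing_tbrackets[OF E(1,2,4)] by blast
  note dim = span_dim_le_card[OF A(1,2)]
  have "vectorspace.dim F (P\<lparr>carrier := span A\<rparr>) \<le> (card E + 1) * (card E choose 3)"
    using dim(2) A(3) by linarith
  also have "\<dots> \<le> (d + 1) * (d choose 3)"
    using E(3) by (intro mult_le_mono binomial_right_mono) auto
  finally have "real (vectorspace.dim F (P\<lparr>carrier := span A\<rparr>)) \<le> real ((d + 1) * (d choose 3))"
    by (rule of_nat_mono)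
  also have "\<dots> = real d * ((real d)\<^sup>2 - 1) * (real d - 2) / 6"
    by (simp add: real_choose_3 power2_eq_square field_simps)
  finally show ?thesis
    using A(4) dim(1) abelian_quotient_if_tbracket_mem[OF A(4,5)] by blast
qed

end
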